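(* Let $p$ and $q$ be distinct odd primes with $p<q$, and let $m=\big\lfloor\frac{q-p}{2p}\big\rfloor$. Then $$\sum_{i=\frac{q-1}{2}-m}^{\frac{q-1}{2}}\Big\lfloor\frac{ip}{q}\Big\rfloor=\Big(\frac{p-1}{2}\Big)(m+1).$$
   Context: $\lfloor t\rfloor$ denotes the greatest integer less than or equal to $t$. *)

theory Defs
  imports Complex_Main "HOL-Computational_Algebra.Primes"
begin

end

theory Submission
  imports Defs
begin

text \<open>
  All summands are equal to \<open>(p - 1) / 2\<close>: writing \<open>i = (q - 1) / 2 - k\<close> gives
  \<open>2 i p = q p - p (1 + 2 k)\<close>, and the bound \<open>k \<le> m\<close> says exactly that \<open>p (1 + 2 k) \<le> q\<close>.
\<close>

text \<open>With \<open>p = 2 * a + 1\<close>, \<open>upper\<close> gives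
  \<open>2 * i * p \<le> 2 * a * q + q - p\<close> and \<open>lower\<close> gives
  \<open>2 * a * q \<le> 2 * i * p\<close>, so dividing \<open>i * p\<close> by \<open>q\<close>
  leaves quotient \<open>a\<close>.\<close>

lemma floor_mult_div_eq_half:
  fixes p q i :: int
  assumes "odd p" "odd q" "0 < p" "0 < q"
    and upper: "i \<le> (q - 1) div 2"
    and lower: "2 * p * ((q - 1) div 2 - i) \<le> q - p"
  shows "\<lfloor>of_int i * of_int p / (of_int q :: real)\<rfloor> = (p - 1) div 2"
proof -
  obtain a b where a: "p = 2 * a + 1" and b: "q = 2 * b + 1"
    using assms by (auto elim!: oddE)
  have "i * p \<le> b * p"
    using upper b \<open>0 < p\<close> by simp
  \<comment> \<open>Both sides equal \<open>p * q\<close>; this converts bounds around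
    \<open>b * p\<close> into bounds around \<open>a * q\<close>.\<close>
  moreover have "2 * (b * p) + p = 2 * (a * q) + q"
    by (simp add: a b algebra_simps)
  moreover have "2 * (b * p) - 2 * (i * p) \<le> q - p"
    using lower b by (simp add: algebra_simps)
  ultimately have "a * q \<le> i * p" "i * p < a * q + q"
    using \<open>0 < p\<close> \<open>0 < q\<close> by linarith+
  then have "(i * p) div q = a"
    using \<open>0 < q\<close> by (intro int_div_pos_eq[where r = "i * p - a * q"]) (auto simp: algebra_simps)
  then show ?thesis
    using a floor_divide_of_int_eq[of "i * p" q, where ?'a = real] by simp
qed

theorem theorem13:
  fixes p q :: nat and m :: int
  assumes "prime p" and "odd p" and "prime q" and "odd q"
    and "p \<noteq> q" and "p < q"
    and "m = \<lfloor>(real q - real p) / (2 * real p)\<rfloor>"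
  shows "(\<Sum>i = (int q - 1) div 2 - m..(int q - 1) div 2. \<lfloor>real_of_int i * real p / real q\<rfloor>)
         = ((int p - 1) div 2) * (m + 1)"
proof -
  have pos: "0 < p" "0 < q"
    using assms by (auto simp: prime_gt_0_nat)
  \<comment> \<open>Follows from \<open>p < q\<close>; it ensures that the summation interval has
    exactly \<open>m + 1\<close> elements.\<close>
  have "0 \<le> m"
    using assms by simp
  have "real_of_int m \<le> (real q - real p) / (2 * real p)"
    using assms by simp
  then have "real_of_int (2 * int p * m) \<le> real_of_int (int q - int p)"
    using pos by (simp add: field_simps)
  then have m: "2 * int p * m \<le> int q - int p"
    by (simp only: of_int_le_iff)
  have "\<lfloor>real_of_int i * real p / real q\<rfloor> = (int p - 1) div 2"
    if "i \<in> {(int q - 1) div 2 - m..(int q - 1) div 2}" for i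
  proof -
    \<comment> \<open>The distance of \<open>i\<close> from the upper end of the interval is at most
      \<open>m\<close>.\<close>
    have "2 * int p * ((int q - 1) div 2 - i) \<le> 2 * int p * m"
      using that by (intro mult_left_mono) auto
    then have "2 * int p * ((int q - 1) div 2 - i) \<le> int q - int p"
      using m by linarith
    then show ?thesis
      using floor_mult_div_eq_half[of "int p" "int q" i] that assms pos by simp
  qed
  then show ?thesis
    using \<open>0 \<le> m\<close> by simp
qed

end
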